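(* $\mathcal P_+ = \mathcal P_- = \mathcal P_{cons}$.
   Context: For $\varepsilon\in\{-1,1\}$ and positive integers $n>m$, let $D_\varepsilon(n,m)=n^n+\varepsilon (n-m)^{n-m}m^m$. For $\varepsilon\in\{-1,1\}$, let $\mathcal P_\varepsilon$ be the set of primes $p$ for which there exist positive integers $n>m$ with $p\nmid m$ and $p^2\mid D_\varepsilon(n,m)$; write $\mathcal P_+=\mathcal P_1$ and $\mathcal P_-=\mathcal P_{-1}$. For a prime $p$, an integer $x$ is a nonzero $p$th power modulo $p^2$ if $x\equiv a^p \pmod{p^2}$ for some integer $a$ and $x\not\equiv 0\pmod p$; two $p$th powers $x,y$ modulo $p^2$ are consecutive if $y-x\equiv \pm1\pmod{p^2}$. Let $\mathcal P_{cons}$ be the set of primes $p$ for which there exist two consecutive nonzero $p$th powers modulo $p^2$. *)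

theory Defs
  imports "HOL-Number_Theory.Number_Theory"
begin

text \<open>
  Used only for \<open>\<epsilon> \<in> {-1, 1}\<close> and \<open>0 < m < n\<close>, so the truncated subtraction
  on natural numbers is the true difference.
\<close>
definition D :: "int \<Rightarrow> nat \<Rightarrow> nat \<Rightarrow> int" where
  "D \<epsilon> n m = int n ^ n + \<epsilon> * int (n - m) ^ (n - m) * int m ^ m"

definition P_eps :: "int \<Rightarrow> nat set" where
  "P_eps \<epsilon> = {p. prime p \<and>
     (\<exists>n m. 0 < m \<and> m < n \<and> \<not> p dvd m \<and> (int p)\<^sup>2 dvd D \<epsilon> n m)}"

definition P_plus :: "nat set" where
  "P_plus = P_eps 1"

definition P_minus :: "nat set" where
  "P_minus = P_eps (-1)"

definition nonzero_pth_power :: "nat \<Rightarrow> int \<Rightarrow> bool" where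
  "nonzero_pth_power p x \<longleftrightarrow>
     (\<exists>a::int. [x = a ^ p] (mod (int p)\<^sup>2)) \<and> \<not> [x = 0] (mod int p)"

definition consecutive_mod_sq :: "nat \<Rightarrow> int \<Rightarrow> int \<Rightarrow> bool" where
  "consecutive_mod_sq p x y \<longleftrightarrow>
     [y - x = 1] (mod (int p)\<^sup>2) \<or> [y - x = -1] (mod (int p)\<^sup>2)"

definition P_cons :: "nat set" where
  "P_cons = {p. prime p \<and>
     (\<exists>x y. nonzero_pth_power p x \<and> nonzero_pth_power p y \<and> consecutive_mod_sq p x y)}"

end

theory Submission
  imports Defs
begin

text \<open>
  Write \<open>n = k + m\<close> with \<open>k\<close>, \<open>m\<close>, \<open>n\<close> prime to the odd prime \<open>p\<close>. If \<open>u ^ (p - 1) = 1 + p * q u\<close>, then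
  \<open>(u ^ u) ^ (p - 1)\<close> is congruent to \<open>1 + p * u * q u = 1 + (u ^ p - u)\<close> modulo \<open>p\<^sup>2\<close>. Hence the
  \<open>(p - 1)\<close>-th powers of \<open>n ^ n\<close> and \<open>\<plusminus> k ^ k * m ^ m\<close> agree modulo \<open>p\<^sup>2\<close> iff
  \<open>n ^ p\<close> is congruent to \<open>k ^ p + m ^ p\<close>; dividing by \<open>m ^ p\<close> yields consecutive \<open>p\<close>-th powers.
  Conversely, \<open>n ^ n\<close> and \<open>-\<epsilon> * k ^ k * m ^ m\<close> with equal \<open>(p - 1)\<close>-th powers modulo \<open>p\<^sup>2\<close> are
  congruent modulo \<open>p\<^sup>2\<close> as soon as they are so modulo \<open>p\<close>, which can be arranged through the
  residues of \<open>k\<close> and \<open>m\<close> modulo \<open>p - 1\<close>. For \<open>\<epsilon> = 1\<close> this needs \<open>-1\<close> among the powers of \<open>b\<close> or \<open>-b\<close>,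
  where \<open>a ^ p - b ^ p\<close> is congruent to \<open>1\<close>; the pair \<open>(a, b)\<close> may be replaced by \<open>(-b, -a)\<close>.
\<close>

section \<open>Congruences modulo p and modulo its square\<close>

text \<open>The factor \<open>x - y\<close> of \<open>x ^ p - y ^ p\<close> supplies one p. The
  cofactor supplies the other, being a sum of p terms that are all congruent to
  \<open>y ^ (p - 1)\<close> modulo p.\<close>

lemma cong_pow_self_square:
  fixes x y :: int
  assumes "[x = y] (mod int p)"
  shows "[x ^ p = y ^ p] (mod (int p)\<^sup>2)"
proof -
  have "[(\<Sum>i<p. y ^ (p - Suc i) * x ^ i) = (\<Sum>i<p. y ^ (p - Suc i) * y ^ i)] (mod int p)"
    by (intro cong_sum cong_mult cong_pow assms cong_refl)
  also have "(\<Sum>i<p. y ^ (p - Suc i) * y ^ i) = (\<Sum>i<p. y ^ (p - 1))"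
    by (intro sum.cong) (auto simp flip: power_add)
  also have "[\<dots> = 0] (mod int p)"
    by (simp add: cong_0_iff)
  finally have "int p dvd (\<Sum>i<p. y ^ (p - Suc i) * x ^ i)"
    by (simp add: cong_0_iff)
  moreover have "int p dvd x - y"
    using assms by (simp add: cong_iff_dvd_diff)
  ultimately have "int p * int p dvd x ^ p - y ^ p"
    unfolding power_diff_sumr2 by (intro mult_dvd_mono)
  then show ?thesis
    by (simp add: cong_iff_dvd_diff power2_eq_square)
qed

lemma cong_one_plus_power:
  fixes q :: int
  shows "[(1 + d * q) ^ u = 1 + d * (int u * q)] (mod d\<^sup>2)"
proof (induction u)
  case (Suc u)
  have "[(1 + d * q) * (1 + d * q) ^ u = (1 + d * q) * (1 + d * (int u * q))] (mod d\<^sup>2)"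
    by (intro cong_mult Suc cong_refl)
  also have "(1 + d * q) * (1 + d * (int u * q)) =
      1 + d * (int (Suc u) * q) + d\<^sup>2 * (int u * q * q)"
    by (simp add: algebra_simps power2_eq_square)
  also have "[\<dots> = 1 + d * (int (Suc u) * q)] (mod d\<^sup>2)"
    by (simp add: cong_iff_dvd_diff)
  finally show ?case
    by simp
qed simp

lemma fermat_int:
  fixes a :: int
  assumes "prime p" "\<not> int p dvd a"
  shows "[a ^ (p - 1) = 1] (mod int p)"
proof -
  have p: "p > 0" using assms prime_gt_0_nat by blast
  have e: "int (nat (a mod int p)) = a mod int p" using p by simp
  have "\<not> p dvd nat (a mod int p)"
    using assms(2) by (metis e dvd_mod_iff int_dvd_int_iff dvd_refl)
  then have "[nat (a mod int p) ^ (p - 1) = 1] (mod p)"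
    using fermat_theorem assms(1) by blast
  then have "[(a mod int p) ^ (p - 1) = 1] (mod int p)"
    by (metis e cong_int_iff of_nat_1 of_nat_power)
  then show ?thesis
    by (simp add: cong_def power_mod)
qed

lemma fermat_int_power_prime:
  fixes a :: int
  assumes "prime p"
  shows "[a ^ p = a] (mod int p)"
proof (cases "int p dvd a")
  case True
  then show ?thesis using assms
    by (metis cong_0_iff cong_sym cong_trans dvd_power dvd_trans prime_gt_0_nat)
next
  case False
  have "[a * a ^ (p - 1) = a * 1] (mod int p)"
    by (intro cong_mult fermat_int assms False cong_refl)
  then show ?thesis
    using assms prime_gt_0_nat by (metis mult_1_right power_eq_if not_gr0)
qed

lemma self_power_cong:
  assumes "prime p" "\<not> p dvd u"
  shows "[(int u ^ u) ^ (p - 1) = 1 + (int u ^ p - int u)] (mod (int p)\<^sup>2)"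
proof -
  have "[int u ^ (p - 1) = 1] (mod int p)"
    using fermat_int assms by simp
  then obtain q where q: "int u ^ (p - 1) = 1 + int p * q"
    by (metis cong_iff_lin cong_sym mult.commute)
  have "int u ^ p = int u * int u ^ (p - 1)"
    using assms(1) by (metis not_prime_0 power_eq_if)
  then have "int u ^ p - int u = int p * (int u * q)"
    by (simp only: q) (simp add: algebra_simps)
  moreover have "(int u ^ u) ^ (p - 1) = (1 + int p * q) ^ u"
    by (metis q power_mult mult.commute)
  ultimately show ?thesis
    using cong_one_plus_power[of "int p" q u] by simp
qed

text \<open>By Fermat p divides both \<open>?a\<close> and \<open>?b\<close>, so their product
  vanishes modulo the square of p. The linear terms then cancel because \<open>k + m\<close> is
  their exact sum, and only p-th powers remain.\<close>

lemma self_power_cong_iff: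
  assumes p: "prime p" and nd: "\<not> p dvd k" "\<not> p dvd m" "\<not> p dvd k + m"
  shows "[(int (k + m) ^ (k + m)) ^ (p - 1) = (int k ^ k * int m ^ m) ^ (p - 1)] (mod (int p)\<^sup>2)
    \<longleftrightarrow> [int (k + m) ^ p = int k ^ p + int m ^ p] (mod (int p)\<^sup>2)"
    (is "[?L = ?R] (mod ?q) \<longleftrightarrow> _")
proof -
  let ?a = "int k ^ p - int k" and ?b = "int m ^ p - int m"
  have "int p dvd ?a" "int p dvd ?b"
    using fermat_int_power_prime[OF p] by (simp_all add: cong_iff_dvd_diff)
  then have ab: "?q dvd ?a * ?b"
    unfolding power2_eq_square by (rule mult_dvd_mono)
  have "[?R = (1 + ?a) * (1 + ?b)] (mod ?q)"
    unfolding power_mult_distrib by (intro cong_mult self_power_cong p nd)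
  also have "(1 + ?a) * (1 + ?b) = 1 + ?a + ?b + ?a * ?b"
    by (simp add: algebra_simps)
  also have "[\<dots> = 1 + ?a + ?b] (mod ?q)"
    using ab by (simp add: cong_iff_dvd_diff)
  finally have R: "[?R = 1 + ?a + ?b] (mod ?q)" .
  have L: "[?L = 1 + (int (k + m) ^ p - int (k + m))] (mod ?q)"
    by (intro self_power_cong p nd)
  have "[?L = ?R] (mod ?q) \<longleftrightarrow> [1 + (int (k + m) ^ p - int (k + m)) = 1 + ?a + ?b] (mod ?q)"
    using L R by (meson cong_sym cong_trans)
  also have "\<dots> \<longleftrightarrow> [int (k + m) ^ p = int k ^ p + int m ^ p] (mod ?q)"
    by (simp add: cong_iff_dvd_diff algebra_simps)
  finally show ?thesis .
qed

text \<open>The congruence modulo p lifts to p-th powers modulo the square of p; cancelling the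
  common (p - 1)-th power, a unit, leaves x and y themselves.\<close>

lemma cong_square_of_cong_power:
  fixes x y :: int
  assumes p: "prime p" and nd: "\<not> int p dvd x"
    and c: "[x = y] (mod int p)" and e: "[x ^ (p - 1) = y ^ (p - 1)] (mod (int p)\<^sup>2)"
  shows "[x = y] (mod (int p)\<^sup>2)"
proof -
  have s: "z ^ p = z * z ^ (p - 1)" for z :: int
    using p by (metis not_prime_0 power_eq_if)
  have "[x * x ^ (p - 1) = y * y ^ (p - 1)] (mod (int p)\<^sup>2)"
    using cong_pow_self_square[OF c] by (simp only: s)
  moreover have "[y * x ^ (p - 1) = y * y ^ (p - 1)] (mod (int p)\<^sup>2)"
    using e by (rule cong_scalar_left)
  ultimately have "[x * x ^ (p - 1) = y * x ^ (p - 1)] (mod (int p)\<^sup>2)"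
    using cong_sym cong_trans by blast
  moreover have "coprime (x ^ (p - 1)) ((int p)\<^sup>2)"
    using p nd prime_imp_coprime[of "int p" x] by (simp add: coprime_commute)
  ultimately show ?thesis
    by (simp add: cong_mult_rcancel)
qed

section \<open>From divisibility to consecutive powers\<close>

text \<open>For odd m exactly one of n and \<open>n - m\<close> is even, so exactly one of the two
  summands of \<open>D \<epsilon> n m\<close> is even.\<close>

lemma two_notin_P_eps:
  assumes "\<epsilon> \<in> {-1, 1}"
  shows "2 \<notin> P_eps \<epsilon>"
proof
  assume "2 \<in> P_eps \<epsilon>"
  then obtain n m where nm: "0 < m" "m < n" "odd m" "2\<^sup>2 dvd D \<epsilon> n m"
    by (auto simp: P_eps_def)
  then have "even (D \<epsilon> n m)"
    by (metis dvd_trans dvd_triv_left power2_eq_square)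
  moreover have "odd \<epsilon>" using assms by auto
  ultimately show False using nm
    by (cases "even n") (auto simp: D_def)
qed

lemma P_eps_subset_P_cons:
  assumes eps: "\<epsilon> \<in> {-1, 1}"
  shows "P_eps \<epsilon> \<subseteq> P_cons"
proof
  fix p assume pP: "p \<in> P_eps \<epsilon>"
  then obtain n m where p: "prime p" and nm: "0 < m" "m < n" "\<not> p dvd m"
    and dv: "(int p)\<^sup>2 dvd D \<epsilon> n m"
    by (auto simp: P_eps_def)
  have "p \<noteq> 2" using pP two_notin_P_eps[OF eps] by auto
  then have "odd p" using p primes_dvd_imp_eq two_is_prime_nat by blast
  \<comment> \<open>Since \<open>p - 1\<close> is even, passing to (p - 1)-th powers erases the
    sign.\<close>
  then have eps_pow: "\<epsilon> ^ (p - 1) = 1" "(- \<epsilon>) ^ (p - 1) = 1" using eps by auto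
  define k where "k = n - m"
  have n: "n = k + m" and k: "k > 0" and n0: "n > 0" using nm by (auto simp: k_def)
  let ?q = "(int p)\<^sup>2"
  have dv': "?q dvd int n ^ n + \<epsilon> * (int k ^ k * int m ^ m)"
    using dv by (simp add: D_def k_def mult.assoc)
  then have dp: "int p dvd int n ^ n + \<epsilon> * (int k ^ k * int m ^ m)"
    by (metis dvd_trans dvd_triv_left power2_eq_square)
  have pi: "prime (int p)" using p by simp
  have eu: "\<not> int p dvd \<epsilon>" using eps prime_gt_1_nat[OF p] by auto
  have nk: "p dvd n \<longleftrightarrow> p dvd k"
  proof
    assume "p dvd n"
    then have "int p dvd int n ^ n" using n0 by (meson dvd_power dvd_trans int_dvd_int_iff)
    then have "int p dvd \<epsilon> * (int k ^ k * int m ^ m)" using dp by (simp add: dvd_add_right_iff)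
    then show "p dvd k" using eu nm pi by (auto simp: prime_dvd_mult_iff prime_dvd_power_iff k)
  next
    assume "p dvd k"
    then have "int p dvd int k ^ k" using k by (meson dvd_power dvd_trans int_dvd_int_iff)
    then have "int p dvd \<epsilon> * (int k ^ k * int m ^ m)" by simp
    then have "int p dvd int n ^ n" using dp by (simp add: dvd_add_left_iff)
    then show "p dvd n" using pi n0 by (simp add: prime_dvd_power_iff)
  qed
  \<comment> \<open>If p divided one of k and n, it would divide both, hence also m.\<close>
  have nd: "\<not> p dvd k" "\<not> p dvd k + m"
    using nk nm unfolding n by (auto simp: dvd_add_right_iff)
  have "[int n ^ n = (- \<epsilon>) * (int k ^ k * int m ^ m)] (mod ?q)"
    using dv' by (simp add: cong_iff_dvd_diff)
  then have "[(int n ^ n) ^ (p - 1) = ((- \<epsilon>) * (int k ^ k * int m ^ m)) ^ (p - 1)] (mod ?q)"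
    by (rule cong_pow)
  then have "[(int n ^ n) ^ (p - 1) = (int k ^ k * int m ^ m) ^ (p - 1)] (mod ?q)"
    by (simp only: power_mult_distrib[of "- \<epsilon>"] eps_pow mult_1_left)
  then have sum: "[int n ^ p = int k ^ p + int m ^ p] (mod ?q)"
    using self_power_cong_iff[OF p nd(1) nm(3) nd(2)] by (simp only: n)
  have "coprime (int m) ?q"
    using p nm prime_imp_coprime[of "int p" "int m"] by (simp add: coprime_commute)
  \<comment> \<open>Multiplying by the p-th power of this inverse of m turns the summand
    \<open>int m ^ p\<close> into 1.\<close>
  then obtain w where w: "[int m * w = 1] (mod ?q)"
    using cong_solve_coprime_int by blast
  have "[int m * w = 1] (mod int p)"
    using w by (metis cong_modulus_mult power2_eq_square)
  then have wnd: "\<not> int p dvd w"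
    using pi by (metis cong_dvd_iff dvd_mult not_prime_unit)
  have nz: "nonzero_pth_power p ((int u * w) ^ p)" if "\<not> p dvd u" for u
  proof -
    have "\<not> int p dvd int u * w"
      using that wnd pi by (simp add: prime_dvd_mult_iff)
    then have "\<not> int p dvd (int u * w) ^ p"
      using pi prime_dvd_power by blast
    then show ?thesis
      unfolding nonzero_pth_power_def cong_0_iff using cong_refl by blast
  qed
  have "[int n ^ p * w ^ p = (int k ^ p + int m ^ p) * w ^ p] (mod ?q)"
    using sum by (rule cong_scalar_right)
  also have "(int k ^ p + int m ^ p) * w ^ p = (int k * w) ^ p + (int m * w) ^ p"
    by (simp add: power_mult_distrib algebra_simps)
  also have "[\<dots> = (int k * w) ^ p + 1 ^ p] (mod ?q)"
    by (intro cong_add cong_pow w cong_refl)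
  finally have "[(int n * w) ^ p - (int k * w) ^ p = 1] (mod ?q)"
    by (simp add: power_mult_distrib cong_iff_dvd_diff algebra_simps)
  then show "p \<in> P_cons"
    using p nz[of k] nz[of n] nd unfolding P_cons_def consecutive_mod_sq_def n by blast
qed

section \<open>From consecutive powers to divisibility\<close>

text \<open>
  Bases only matter modulo \<open>p\<close> and exponents only modulo \<open>p - 1\<close>, so the Chinese remainder
  theorem lets the exponents \<open>e\<close> and \<open>f\<close> be prescribed independently of \<open>a\<close> and \<open>b\<close>.
\<close>
lemma P_eps_if_exponents:
  fixes a b :: int
  assumes eps: "\<epsilon> \<in> {-1, 1}" and p: "prime p" "odd p"
    and nd: "\<not> int p dvd a" "\<not> int p dvd b"
    and cons: "[a ^ p - b ^ p = 1] (mod (int p)\<^sup>2)"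
    and ex: "[a ^ (e + f) = - \<epsilon> * b ^ e] (mod int p)"
  shows "p \<in> P_eps \<epsilon>"
proof -
  let ?q = "(int p)\<^sup>2"
  have p2: "p > 2" using p by (metis order_le_imp_less_or_eq prime_ge_2_nat even_numeral)
  \<comment> \<open>Explicit Chinese remaindering: p is 0 modulo p and 1 modulo
    \<open>p - 1\<close>, while \<open>(p - 1)\<^sup>2\<close> is 1 modulo p and 0 modulo
    \<open>p - 1\<close>. So k has residues b and e, and m has residues 1 and f.\<close>
  define k where "k = e * p + nat (b mod int p) * (p - 1)\<^sup>2"
  define m where "m = f * p + (p - 1)\<^sup>2"
  have "0 < m" using p2 by (simp add: m_def)
  have kb: "[int k = b] (mod int p)" and mb: "[int m = 1] (mod int p)"
  proof -
    have "[int p - 1 = -1] (mod int p)" by (simp add: cong_iff_dvd_diff)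
    then have s: "[(int p - 1)\<^sup>2 = (-1)\<^sup>2] (mod int p)" by (rule cong_pow)
    have z: "[int c * int p = 0] (mod int p)" for c by (simp add: cong_0_iff)
    have k: "int k = int e * int p + (b mod int p) * (int p - 1)\<^sup>2"
      using p2 by (simp add: k_def of_nat_diff)
    have m: "int m = int f * int p + (int p - 1)\<^sup>2"
      using p2 by (simp add: m_def of_nat_diff)
    have "[int k = 0 + b * (-1)\<^sup>2] (mod int p)"
      unfolding k by (intro cong_add cong_mult z s) simp
    then show "[int k = b] (mod int p)" by simp
    have "[int m = 0 + (-1)\<^sup>2] (mod int p)"
      unfolding m by (intro cong_add z s)
    then show "[int m = 1] (mod int p)" by simp
  qed
  obtain k' where k': "k = e + (p - 1) * k'"
  proof
    show "k = e + (p - 1) * (e + nat (b mod int p) * (p - 1))"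
      using p2 by (cases p) (auto simp: k_def power2_eq_square algebra_simps)
  qed
  obtain m' where m': "m = f + (p - 1) * m'"
  proof
    show "m = f + (p - 1) * (f + (p - 1))"
      using p2 by (cases p) (auto simp: m_def power2_eq_square algebra_simps)
  qed
  have red: "[c ^ (i + (p - 1) * j) = c ^ i] (mod int p)" if "\<not> int p dvd c" for c i j
  proof -
    have "[c ^ i * (c ^ (p - 1)) ^ j = c ^ i * 1 ^ j] (mod int p)"
      by (intro cong_mult cong_pow fermat_int p that cong_refl)
    then show ?thesis by (simp add: power_add power_mult)
  qed
  \<comment> \<open>Fermat reduces \<open>cons\<close> to \<open>a - b\<close> being 1 modulo p, so
    \<open>k + m\<close> has residue a.\<close>
  have "[a ^ p - b ^ p = 1] (mod int p)"
    using cons by (metis cong_modulus_mult power2_eq_square)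
  moreover have "[a ^ p - b ^ p = a - b] (mod int p)"
    by (intro cong_diff fermat_int_power_prime p)
  ultimately have "[a - b = 1] (mod int p)"
    using cong_sym cong_trans by blast
  then have "[b + 1 = a] (mod int p)"
    by (metis cong_add_lcancel diff_add_cancel add.commute cong_sym)
  moreover have "[int (k + m) = b + 1] (mod int p)"
    unfolding of_nat_add by (intro cong_add kb mb)
  ultimately have na: "[int (k + m) = a] (mod int p)"
    using cong_trans by blast
  have ndk: "\<not> p dvd k" "\<not> p dvd k + m"
    using nd kb na by (metis cong_dvd_iff int_dvd_int_iff)+
  have ndm: "\<not> p dvd m"
    using cong_dvd_iff[OF mb] p2 by auto
  have "k > 0" using ndk(1) by (cases k) auto
  have pi: "prime (int p)" using p by simp
  have sum: "[int (k + m) ^ p = int k ^ p + int m ^ p] (mod ?q)"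
  proof -
    have "[int (k + m) ^ p = a ^ p] (mod ?q)"
      by (intro cong_pow_self_square na)
    also have "[a ^ p = b ^ p + 1 ^ p] (mod ?q)"
      using cons by (simp add: cong_iff_dvd_diff algebra_simps)
    also have "[b ^ p + 1 ^ p = int k ^ p + int m ^ p] (mod ?q)"
      by (intro cong_add cong_pow_self_square cong_sym[OF kb] cong_sym[OF mb])
    finally show ?thesis .
  qed
  have eps_pow: "(- \<epsilon>) ^ (p - 1) = 1" using eps p by auto
  have modp: "[int (k + m) ^ (k + m) = - \<epsilon> * (int k ^ k * int m ^ m)] (mod int p)"
  proof -
    have "[int (k + m) ^ (k + m) = a ^ (k + m)] (mod int p)"
      by (intro cong_pow na)
    also have "a ^ (k + m) = a ^ ((e + f) + (p - 1) * (k' + m'))"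
      unfolding k' m' by (simp add: distrib_left add_ac)
    also have "[\<dots> = a ^ (e + f)] (mod int p)"
      by (intro red nd)
    also note ex
    also have "[- \<epsilon> * b ^ e = - \<epsilon> * (b ^ k * 1 ^ m)] (mod int p)"
      using cong_scalar_left[OF cong_sym[OF red[OF nd(2), of e k']], of "- \<epsilon>"] by (simp add: k')
    also have "[- \<epsilon> * (b ^ k * 1 ^ m) = - \<epsilon> * (int k ^ k * int m ^ m)] (mod int p)"
      by (intro cong_mult cong_pow cong_refl cong_sym[OF kb] cong_sym[OF mb])
    finally show ?thesis .
  qed
  have "[int (k + m) ^ (k + m) = - \<epsilon> * (int k ^ k * int m ^ m)] (mod ?q)"
  proof (rule cong_square_of_cong_power[OF p(1) _ modp])
    show "\<not> int p dvd int (k + m) ^ (k + m)"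
      using ndk(2) pi by (metis int_dvd_int_iff prime_dvd_power)
    show "[(int (k + m) ^ (k + m)) ^ (p - 1) = (- \<epsilon> * (int k ^ k * int m ^ m)) ^ (p - 1)] (mod ?q)"
      using sum self_power_cong_iff[OF p(1) ndk(1) ndm ndk(2)]
      by (simp only: power_mult_distrib[of "- \<epsilon>"] eps_pow mult_1_left)
  qed
  then have "?q dvd D \<epsilon> (k + m) m"
    by (simp add: D_def cong_iff_dvd_diff mult.assoc)
  moreover have "m < k + m"
    using \<open>k > 0\<close> by simp
  ultimately show ?thesis
    unfolding P_eps_def using p \<open>0 < m\<close> ndm by blast
qed

text \<open>Let r be the order of b modulo p. If r is even, the power of b to half of r is a square
  root of 1 other than 1, hence -1; if r is odd, \<open>(-b) ^ r\<close> is -1.\<close>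

lemma exists_power_cong_minus_one:
  fixes b :: int
  assumes p: "prime p" and nd: "\<not> int p dvd b"
  shows "\<exists>j. [b ^ j = -1] (mod int p) \<or> [(-b) ^ j = -1] (mod int p)"
proof -
  define r where "r = (LEAST r. r > 0 \<and> [b ^ r = 1] (mod int p))"
  have "p - 1 > 0 \<and> [b ^ (p - 1) = 1] (mod int p)"
    using fermat_int[OF p nd] prime_gt_1_nat[OF p] by simp
  then have r: "r > 0" "[b ^ r = 1] (mod int p)"
    unfolding r_def using LeastI[of "\<lambda>r. r > 0 \<and> [b ^ r = 1] (mod int p)" "p - 1"] by blast+
  show ?thesis
  proof (cases "even r")
    case True
    then obtain j where j: "r = 2 * j" by blast
    have "j < r" "j > 0" using r j by auto
    then have n1: "\<not> [b ^ j = 1] (mod int p)"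
      using not_less_Least unfolding r_def by blast
    have "int p dvd b ^ r - 1"
      using r by (simp add: cong_iff_dvd_diff)
    also have "b ^ r - 1 = (b ^ j - 1) * (b ^ j + 1)"
      unfolding j mult_2 power_add by (simp add: algebra_simps)
    finally have "int p dvd b ^ j + 1"
      using n1 p by (simp add: prime_dvd_mult_iff cong_iff_dvd_diff)
    then show ?thesis by (auto simp: cong_iff_dvd_diff)
  next
    case False
    have "[- (b ^ r) = - 1] (mod int p)" using r by (simp add: cong_minus_minus_iff)
    then show ?thesis using False by (intro exI[of _ r]) simp
  qed
qed

lemma P_cons_subset_P_eps:
  assumes eps: "\<epsilon> \<in> {-1, 1}"
  shows "P_cons \<subseteq> P_eps \<epsilon>"
proof
  fix p assume "p \<in> P_cons"
  \<comment> \<open>The relation is symmetric, so x and y may be swapped to make the difference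
    +1.\<close>
  then obtain x y where p: "prime p" and xy: "nonzero_pth_power p x" "nonzero_pth_power p y"
    and c: "[y - x = 1] (mod (int p)\<^sup>2)"
    unfolding P_cons_def consecutive_mod_sq_def
    by (smt (verit, best) cong_minus_minus_iff mem_Collect_eq minus_diff_eq)
  let ?q = "(int p)\<^sup>2"
  have weak: "[s = t] (mod int p)" if "[s = t] (mod ?q)" for s t
    using that by (metis cong_modulus_mult power2_eq_square)
  have nonzero: "\<not> int p dvd z" if "nonzero_pth_power p z" for z
    using that by (simp add: nonzero_pth_power_def cong_0_iff)
  have odd: "odd p"
  proof
    assume "even p"
    then have "p = 2" using p primes_dvd_imp_eq two_is_prime_nat by blast
    then have "odd x" "odd y" "[y - x = 1] (mod 2)"
      using nonzero[OF xy(1)] nonzero[OF xy(2)] weak[OF c] by auto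
    then show False by (simp add: cong_iff_dvd_diff)
  qed
  obtain a b where ab: "[x = b ^ p] (mod ?q)" "[y = a ^ p] (mod ?q)"
    using xy by (auto simp: nonzero_pth_power_def)
  have "\<not> int p dvd b ^ p" "\<not> int p dvd a ^ p"
    using nonzero xy weak[OF ab(1)] weak[OF ab(2)] by (metis cong_dvd_iff)+
  then have nd: "\<not> int p dvd a" "\<not> int p dvd b"
    using p by (meson dvd_power dvd_trans prime_gt_0_nat)+
  have cons: "[a ^ p - b ^ p = 1] (mod ?q)"
    using cong_diff[OF ab(2) ab(1)] c cong_sym cong_trans by blast
  show "p \<in> P_eps \<epsilon>"
  proof (cases "\<epsilon> = -1")
    case True
    then show ?thesis
      \<comment> \<open>With both exponents 0 the required congruence reads 1 = 1.\<close>
      using P_eps_if_exponents[OF eps p odd nd cons, of 0 0] by simp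
  next
    case False
    then have e1: "\<epsilon> = 1" using eps by simp
    from exists_power_cong_minus_one[OF p nd(2)] obtain j
      where "[b ^ j = -1] (mod int p) \<or> [(-b) ^ j = -1] (mod int p)" by blast
    then show ?thesis
    proof
      assume j: "[b ^ j = -1] (mod int p)"
      \<comment> \<open>Taking \<open>e = j\<close> and \<open>f = j * (p - 2)\<close> makes
        \<open>e + f\<close> a multiple of \<open>p - 1\<close>, so the power of a is 1, matching
        \<open>- (b ^ j)\<close>.\<close>
      obtain r where "p = Suc (Suc r)"
        using prime_ge_2_nat[OF p] by (metis add_2_eq_Suc le_Suc_ex)
      then have r: "j + j * (p - 2) = (p - 1) * j"
        by simp
      have "[(a ^ (p - 1)) ^ j = 1 ^ j] (mod int p)"
        by (intro cong_pow fermat_int p nd)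
      then have "[a ^ (j + j * (p - 2)) = 1] (mod int p)"
        unfolding r by (simp add: power_mult)
      moreover have "[1 = - (b ^ j)] (mod int p)"
        using j by (metis cong_minus_minus_iff cong_sym minus_minus)
      ultimately have "[a ^ (j + j * (p - 2)) = - \<epsilon> * b ^ j] (mod int p)"
        unfolding e1 using cong_trans by fastforce
      then show ?thesis
        by (rule P_eps_if_exponents[OF eps p odd nd cons])
    next
      assume j: "[(-b) ^ j = -1] (mod int p)"
      \<comment> \<open>As p is odd, negating and swapping preserves the difference. With exponents
        0 and j the required congruence is then exactly \<open>j\<close>.\<close>
      have "[(-b) ^ p - (-a) ^ p = 1] (mod ?q)"
        using cons odd by (simp add: algebra_simps)
      then show ?thesis
        using P_eps_if_exponents[OF eps p odd, of "-b" "-a" 0 j] nd j e1 by simp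
    qed
  qed
qed

theorem theorem1p2:
  shows "P_plus = P_minus \<and> P_minus = P_cons"
proof -
  have "P_eps \<epsilon> = P_cons" if "\<epsilon> \<in> {-1, 1}" for \<epsilon>
    using P_eps_subset_P_cons[OF that] P_cons_subset_P_eps[OF that] by blast
  then show ?thesis
    by (simp add: P_plus_def P_minus_def)
qed

end
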